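(* Let $S$ be an inverse semigroup and $T$ an inverse subsemigroup of $S$ such that $S$ is an enlargement of $T$, i.e. $STS=S$ and $TST=T$. Then $S$ and $T$ are strongly Morita equivalent.
   Context: An inverse semigroup is a semigroup $S$ such that for each $s\in S$ there is a unique $s^*\in S$ with $ss^*s=s$ and $s^*ss^*=s^*$. A Morita context is a 5-tuple $(S,T,X,\langle\ ,\ \rangle,[\ ,\ ])$ where $S,T$ are inverse semigroups, $X$ is a set with a left action of $S$ and a right action of $T$ that commute, and $\langle\ ,\ \rangle\colon X\times X\to S$, $[\ ,\ ]\colon X\times X\to T$ are surjective functions such that for all $x,y,z\in X$, $s\in S$, $t\in T$: (1) $\langle sx,y\rangle=s\langle x,y\rangle$; (2) $\langle y,x\rangle=\langle x,y\rangle^*$; (3) $\langle x,x\rangle x=x$; (4) $[x,yt]=[x,y]t$; (5) $[y,x]=[x,y]^*$; (6) $x[x,x]=x$; (7) $\langle x,y\rangle z=x[y,z]$. Then $X$ (with the two maps) is called an equivalence bimodule for $S$ and $T$. Inverse semigroups $S$ and $T$ are strongly Morita equivalent if there exists a Morita context $(S,T,X,\langle\ ,\ \rangle,[\ ,\ ])$. *)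

theory Defs
  imports "HOL-Algebra.Congruence"
begin

record 'a semigrp = "'a partial_object" +
  mult :: "'a \<Rightarrow> 'a \<Rightarrow> 'a" (infixl \<open>\<otimes>\<index>\<close> 70)

locale inverse_semigroup =
  fixes S :: "('a, 'm) semigrp_scheme" (structure)
  assumes mult_closed: "\<lbrakk>a \<in> carrier S; b \<in> carrier S\<rbrakk> \<Longrightarrow> a \<otimes> b \<in> carrier S"
    and mult_assoc: "\<lbrakk>a \<in> carrier S; b \<in> carrier S; c \<in> carrier S\<rbrakk> \<Longrightarrow>
      (a \<otimes> b) \<otimes> c = a \<otimes> (b \<otimes> c)"
    and ex1_star: "s \<in> carrier S \<Longrightarrow>
      \<exists>!t. t \<in> carrier S \<and> s \<otimes> t \<otimes> s = s \<and> t \<otimes> s \<otimes> t = t"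

definition star :: "('a, 'm) semigrp_scheme \<Rightarrow> 'a \<Rightarrow> 'a"
  where "star S s = (THE t. t \<in> carrier S \<and> s \<otimes>\<^bsub>S\<^esub> t \<otimes>\<^bsub>S\<^esub> s = s \<and> t \<otimes>\<^bsub>S\<^esub> s \<otimes>\<^bsub>S\<^esub> t = t)"

definition inverse_subsemigroup :: "'a set \<Rightarrow> ('a, 'm) semigrp_scheme \<Rightarrow> bool"
  where "inverse_subsemigroup T S \<longleftrightarrow>
    T \<subseteq> carrier S \<and>
    (\<forall>a\<in>T. \<forall>b\<in>T. a \<otimes>\<^bsub>S\<^esub> b \<in> T) \<and>
    (\<forall>a\<in>T. star S a \<in> T)"

definition set_prod :: "('a, 'm) semigrp_scheme \<Rightarrow> 'a set \<Rightarrow> 'a set \<Rightarrow> 'a set"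
  where "set_prod S A B = {a \<otimes>\<^bsub>S\<^esub> b | a b. a \<in> A \<and> b \<in> B}"

definition enlargement :: "('a, 'm) semigrp_scheme \<Rightarrow> 'a set \<Rightarrow> bool"
  where "enlargement S T \<longleftrightarrow>
    set_prod S (set_prod S (carrier S) T) (carrier S) = carrier S \<and>
    set_prod S (set_prod S T (carrier S)) T = T"

locale morita_context = S: inverse_semigroup S + T: inverse_semigroup T
  for S :: "('a, 'm) semigrp_scheme" and T :: "('b, 'n) semigrp_scheme" +
  fixes X :: "'x set"
    and lact :: "'a \<Rightarrow> 'x \<Rightarrow> 'x" (infixr \<open>\<rhd>\<close> 75)
    and ract :: "'x \<Rightarrow> 'b \<Rightarrow> 'x" (infixl \<open>\<lhd>\<close> 75)
    and lform :: "'x \<Rightarrow> 'x \<Rightarrow> 'a"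
    and rform :: "'x \<Rightarrow> 'x \<Rightarrow> 'b"
  assumes lact_closed: "\<lbrakk>s \<in> carrier S; x \<in> X\<rbrakk> \<Longrightarrow> s \<rhd> x \<in> X"
    and lact_mult: "\<lbrakk>s \<in> carrier S; s' \<in> carrier S; x \<in> X\<rbrakk> \<Longrightarrow>
      (s \<otimes>\<^bsub>S\<^esub> s') \<rhd> x = s \<rhd> (s' \<rhd> x)"
    and ract_closed: "\<lbrakk>x \<in> X; t \<in> carrier T\<rbrakk> \<Longrightarrow> x \<lhd> t \<in> X"
    and ract_mult: "\<lbrakk>x \<in> X; t \<in> carrier T; t' \<in> carrier T\<rbrakk> \<Longrightarrow>
      x \<lhd> (t \<otimes>\<^bsub>T\<^esub> t') = (x \<lhd> t) \<lhd> t'"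
    and act_commute: "\<lbrakk>s \<in> carrier S; x \<in> X; t \<in> carrier T\<rbrakk> \<Longrightarrow>
      (s \<rhd> x) \<lhd> t = s \<rhd> (x \<lhd> t)"
    and lform_surj: "(\<lambda>(x, y). lform x y) ` (X \<times> X) = carrier S"
    and rform_surj: "(\<lambda>(x, y). rform x y) ` (X \<times> X) = carrier T"
    and lform_lact: "\<lbrakk>s \<in> carrier S; x \<in> X; y \<in> X\<rbrakk> \<Longrightarrow> lform (s \<rhd> x) y = s \<otimes>\<^bsub>S\<^esub> lform x y"
    and lform_swap: "\<lbrakk>x \<in> X; y \<in> X\<rbrakk> \<Longrightarrow> lform y x = star S (lform x y)"
    and lform_self: "x \<in> X \<Longrightarrow> lform x x \<rhd> x = x"
    and rform_ract: "\<lbrakk>x \<in> X; y \<in> X; t \<in> carrier T\<rbrakk> \<Longrightarrow> rform x (y \<lhd> t) = rform x y \<otimes>\<^bsub>T\<^esub> t"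
    and rform_swap: "\<lbrakk>x \<in> X; y \<in> X\<rbrakk> \<Longrightarrow> rform y x = star T (rform x y)"
    and rform_self: "x \<in> X \<Longrightarrow> x \<lhd> rform x x = x"
    and lform_rform: "\<lbrakk>x \<in> X; y \<in> X; z \<in> X\<rbrakk> \<Longrightarrow> lform x y \<rhd> z = x \<lhd> rform y z"

text \<open>
  HOL cannot quantify over the type carrying \<open>X\<close>, so a type large enough for every equivalence
  bimodule is fixed. That this is no restriction is the content of
  \<open>strongly_morita_equivalentI\<close> below: a Morita context with \<open>X\<close> in an arbitrary type suffices.
\<close>

definition strongly_morita_equivalent ::
    "('a, 'm) semigrp_scheme \<Rightarrow> ('b, 'n) semigrp_scheme \<Rightarrow> bool"
  where "strongly_morita_equivalent S T \<longleftrightarrow>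
    (\<exists>(X :: ('a \<times> 'b) set) lact ract lform rform. morita_context S T X lact ract lform rform)"

lemma (in morita_context) transport:
  fixes f :: "'x \<Rightarrow> 'y"
  assumes "inj_on f X"
  defines "g \<equiv> inv_into X f"
  shows "morita_context S T (f ` X) (\<lambda>s y. f (s \<rhd> g y)) (\<lambda>y t. f (g y \<lhd> t))
    (\<lambda>y z. lform (g y) (g z)) (\<lambda>y z. rform (g y) (g z))"
proof -
  have gf [simp]: "g (f x) = x" if "x \<in> X" for x
    using that assms by simp
  have lf: "lform x y \<in> carrier S" and rf: "rform x y \<in> carrier T" if "x \<in> X" "y \<in> X" for x y
    using that lform_surj rform_surj by auto
  have im: "(\<lambda>(y, z). lform (g y) (g z)) ` (f ` X \<times> f ` X) = (\<lambda>(x, y). lform x y) ` (X \<times> X)"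
    "(\<lambda>(y, z). rform (g y) (g z)) ` (f ` X \<times> f ` X) = (\<lambda>(x, y). rform x y) ` (X \<times> X)"
    by (force simp: image_iff)+
  show ?thesis
  proof (unfold_locales, goal_cases)
    case 6 show ?case using im lform_surj by simp
  next
    case 7 show ?case using im rform_surj by simp
  next
    case 9 then show ?case by (auto intro: lform_swap)
  next
    case 12 then show ?case by (auto intro: rform_swap)
  qed (auto simp: lf rf lact_closed lact_mult ract_closed ract_mult act_commute lform_lact lform_self
        rform_ract rform_self lform_rform)
qed

lemma strongly_morita_equivalentI:
  fixes S :: "('a, 'm) semigrp_scheme" and T :: "('b, 'n) semigrp_scheme" and X :: "'x set"
  assumes "morita_context S T X lact ract lform rform"
  shows "strongly_morita_equivalent S T"
proof -
  interpret morita_context S T X lact ract lform rform by fact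
  define r where "r x = (SOME y. y \<in> X \<and> rform y y = rform x x)" for x
  define f where "f x = (lform x (r x), rform x x)" for x
  have r: "r x \<in> X" "rform (r x) (r x) = rform x x" if "x \<in> X" for x
    using someI[of "\<lambda>y. y \<in> X \<and> rform y y = rform x x" x] that by (auto simp: r_def)
  have rec: "lact (lform x (r x)) (r x) = x" if "x \<in> X" for x
    using that r lform_rform rform_self by simp
  have "inj_on f X"
  proof (rule inj_onI)
    fix x y assume xy: "x \<in> X" "y \<in> X" "f x = f y"
    then have "r x = r y" "lform x (r x) = lform y (r y)"
      by (auto simp: f_def r_def)
    with rec xy show "x = y" by metis
  qed
  from transport[OF this] show ?thesis
    unfolding strongly_morita_equivalent_def by blast
qed

end

theory Submission
  imports Defs
begin

text \<open>
  The equivalence bimodule is \<open>ST\<close>, with both semigroups acting by multiplication and the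
  forms \<open>\<langle>x, y\<rangle> = x y\<^sup>*\<close> and \<open>[x, y] = x\<^sup>* y\<close>. The latter takes values in \<open>TST = T\<close>, and the
  former is onto because \<open>a t b = (a t) (b\<^sup>* t\<^sup>* t)\<^sup>*\<close> and \<open>STS = S\<close>.
\<close>

context inverse_semigroup
begin

text \<open>The products are bracketed to the right so that these laws still match after rewriting
  with \<open>mult_assoc\<close>.\<close>

lemma
  assumes "s \<in> carrier S"
  shows star_closed: "star S s \<in> carrier S"
    and mult_star_mult: "s \<otimes> (star S s \<otimes> s) = s"
    and star_mult_star: "star S s \<otimes> (s \<otimes> star S s) = star S s"
proof -
  have *: "star S s \<in> carrier S \<and> s \<otimes> star S s \<otimes> s = s \<and> star S s \<otimes> s \<otimes> star S s = star S s"
    unfolding star_def by (rule theI') (rule ex1_star[OF assms])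
  then show "star S s \<in> carrier S" "s \<otimes> (star S s \<otimes> s) = s"
    "star S s \<otimes> (s \<otimes> star S s) = star S s"
    using assms by (simp_all add: mult_assoc[symmetric])
qed

lemma star_eqI:
  assumes "s \<in> carrier S" "t \<in> carrier S" "s \<otimes> (t \<otimes> s) = s" "t \<otimes> (s \<otimes> t) = t"
  shows "star S s = t"
  unfolding star_def
  by (rule the1_equality[OF ex1_star]) (use assms in \<open>simp_all add: mult_assoc\<close>)

lemma star_star: "s \<in> carrier S \<Longrightarrow> star S (star S s) = s"
  by (rule star_eqI) (simp_all add: star_closed mult_star_mult star_mult_star)

text \<open>Let x be the inverse of ef. Then fxe is an inverse of ef as well, so x = fxe by
  uniqueness, and this form makes x idempotent. An idempotent is its own inverse, hence ef, being
  the inverse of x, equals x.\<close>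

lemma idempotent_mult:
  assumes e: "e \<in> carrier S" "e \<otimes> e = e" and f: "f \<in> carrier S" "f \<otimes> f = f"
  shows "(e \<otimes> f) \<otimes> (e \<otimes> f) = e \<otimes> f"
proof -
  define x where "x = star S (e \<otimes> f)"
  have x: "x \<in> carrier S" and ef: "e \<otimes> f \<in> carrier S"
    unfolding x_def using e f by (simp_all add: star_closed mult_closed)
  note cl = e(1) f(1) x mult_closed
  \<comment> \<open>Idempotency with a trailing factor d, the shape in which it occurs inside a
    right-bracketed product.\<close>
  have ee: "e \<otimes> (e \<otimes> d) = e \<otimes> d" and ff: "f \<otimes> (f \<otimes> d) = f \<otimes> d" if "d \<in> carrier S" for d
    using that mult_assoc[OF e(1) e(1)] mult_assoc[OF f(1) f(1)] e(2) f(2) by simp_all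
  have 1: "e \<otimes> (f \<otimes> (x \<otimes> (e \<otimes> f))) = e \<otimes> f"
    using mult_star_mult[OF ef] by (simp add: x_def[symmetric] mult_assoc cl)
  have 2: "x \<otimes> (e \<otimes> (f \<otimes> x)) = x"
    using star_mult_star[OF ef] by (simp add: x_def[symmetric] mult_assoc cl)
  have 3: "x \<otimes> (e \<otimes> (f \<otimes> (x \<otimes> e))) = x \<otimes> e"
    using arg_cong[OF 2, of "\<lambda>y. y \<otimes> e"] by (simp add: mult_assoc cl)
  have "star S (e \<otimes> f) = f \<otimes> (x \<otimes> e)"
    by (rule star_eqI) (simp_all add: mult_assoc cl ee ff 1 3)
  then have fxe: "x = f \<otimes> (x \<otimes> e)"
    by (simp add: x_def)
  \<comment> \<open>In fxe fxe the inner part xefxe contracts to xe, because xefx = x.\<close>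
  have "x \<otimes> x = (f \<otimes> (x \<otimes> e)) \<otimes> (f \<otimes> (x \<otimes> e))"
    using fxe by simp
  also have "\<dots> = f \<otimes> (x \<otimes> e)"
    by (simp add: mult_assoc cl 3)
  finally have xx: "x \<otimes> x = x"
    using fxe by simp
  then have "star S x = x"
    by (intro star_eqI) (simp_all add: x)
  then have "x = e \<otimes> f"
    using star_star[OF ef] by (simp add: x_def)
  with xx show ?thesis by simp
qed

text \<open>Since ef and fe are idempotent, both ef and fe are inverses of ef, and inverses are
  unique.\<close>

lemma idempotents_commute:
  assumes e: "e \<in> carrier S" "e \<otimes> e = e" and f: "f \<in> carrier S" "f \<otimes> f = f"
  shows "e \<otimes> f = f \<otimes> e"
proof -
  note cl = e(1) f(1) mult_closed
  have ee: "e \<otimes> (e \<otimes> d) = e \<otimes> d" and ff: "f \<otimes> (f \<otimes> d) = f \<otimes> d" if "d \<in> carrier S" for d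
    using that mult_assoc[OF e(1) e(1)] mult_assoc[OF f(1) f(1)] e(2) f(2) by simp_all
  have ef: "e \<otimes> (f \<otimes> (e \<otimes> f)) = e \<otimes> f" and fe: "f \<otimes> (e \<otimes> (f \<otimes> e)) = f \<otimes> e"
    using idempotent_mult[OF e f] idempotent_mult[OF f e] by (simp_all add: mult_assoc cl)
  have "star S (e \<otimes> f) = f \<otimes> e"
    by (rule star_eqI) (simp_all add: mult_assoc cl ee ff ef fe)
  moreover have "star S (e \<otimes> f) = e \<otimes> f"
    by (rule star_eqI) (simp_all add: mult_assoc cl ee ff ef)
  ultimately show ?thesis by simp
qed

text \<open>The idempotents \<open>b \<otimes> ?b\<close> and \<open>?a \<otimes> a\<close> meet in
  the middle of the products to be checked. Swapping them brings each next to its own letter, where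
  it is absorbed.\<close>

lemma star_mult:
  assumes a: "a \<in> carrier S" and b: "b \<in> carrier S"
  shows "star S (a \<otimes> b) = star S b \<otimes> star S a"
proof -
  let ?a = "star S a" and ?b = "star S b"
  note cl = a b star_closed[OF a] star_closed[OF b] mult_closed
  have comm: "b \<otimes> ?b \<otimes> (?a \<otimes> a) = ?a \<otimes> a \<otimes> (b \<otimes> ?b)"
    by (rule idempotents_commute) (simp_all add: mult_assoc cl mult_star_mult star_mult_star)
  have "a \<otimes> b \<otimes> (?b \<otimes> ?a \<otimes> (a \<otimes> b)) = a \<otimes> (b \<otimes> ?b \<otimes> (?a \<otimes> a)) \<otimes> b"
    by (simp add: mult_assoc cl)
  also have "\<dots> = (a \<otimes> (?a \<otimes> a)) \<otimes> (b \<otimes> (?b \<otimes> b))"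
    unfolding comm by (simp add: mult_assoc cl)
  finally have 1: "a \<otimes> b \<otimes> (?b \<otimes> ?a \<otimes> (a \<otimes> b)) = a \<otimes> b"
    by (simp add: a b mult_star_mult)
  have "?b \<otimes> ?a \<otimes> (a \<otimes> b \<otimes> (?b \<otimes> ?a)) = ?b \<otimes> (?a \<otimes> a \<otimes> (b \<otimes> ?b)) \<otimes> ?a"
    by (simp add: mult_assoc cl)
  also have "\<dots> = (?b \<otimes> (b \<otimes> ?b)) \<otimes> (?a \<otimes> (a \<otimes> ?a))"
    unfolding comm[symmetric] by (simp add: mult_assoc cl)
  finally have 2: "?b \<otimes> ?a \<otimes> (a \<otimes> b \<otimes> (?b \<otimes> ?a)) = ?b \<otimes> ?a"
    by (simp add: a b star_mult_star)
  show ?thesis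
    by (rule star_eqI) (use 1 2 cl in simp_all)
qed

text \<open>Closure under \<open>star S\<close> gives existence of inverses in T; uniqueness is
  inherited from S.\<close>

lemma inverse_subsemigroup_is_inverse_semigroup:
  assumes "inverse_subsemigroup T S"
  shows "inverse_semigroup (S\<lparr>carrier := T\<rparr>)"
proof -
  have T: "T \<subseteq> carrier S" "\<And>a b. a \<in> T \<Longrightarrow> b \<in> T \<Longrightarrow> a \<otimes> b \<in> T" "\<And>a. a \<in> T \<Longrightarrow> star S a \<in> T"
    using assms by (auto simp: inverse_subsemigroup_def)
  show ?thesis
  proof
    fix s assume "s \<in> carrier (S\<lparr>carrier := T\<rparr>)"
    then have s: "s \<in> T" "s \<in> carrier S" using T by auto
    show "\<exists>!t. t \<in> carrier (S\<lparr>carrier := T\<rparr>) \<and>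
      s \<otimes>\<^bsub>S\<lparr>carrier := T\<rparr>\<^esub> t \<otimes>\<^bsub>S\<lparr>carrier := T\<rparr>\<^esub> s = s \<and>
      t \<otimes>\<^bsub>S\<lparr>carrier := T\<rparr>\<^esub> s \<otimes>\<^bsub>S\<lparr>carrier := T\<rparr>\<^esub> t = t"
    proof (rule ex1I[of _ "star S s"], goal_cases)
      case 1
      then show ?case
        using s T by (simp add: mult_assoc star_closed mult_star_mult star_mult_star)
    next
      case (2 t)
      then have "t \<in> carrier S" using T by auto
      with 2 s show ?case
        by (intro star_eqI[symmetric]) (auto simp: mult_assoc)
    qed
  qed (use T in \<open>auto intro: mult_assoc\<close>)
qed

text \<open>The star of the restricted structure is a description ranging over T only, so its
  agreement with \<open>star S\<close> needs uniqueness in T. The symmetry law of the T-valued form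
  depends on it.\<close>

lemma star_inverse_subsemigroup:
  assumes "inverse_subsemigroup T S" "s \<in> T"
  shows "star (S\<lparr>carrier := T\<rparr>) s = star S s"
proof -
  interpret T: inverse_semigroup "S\<lparr>carrier := T\<rparr>"
    by (rule inverse_subsemigroup_is_inverse_semigroup) fact
  have "s \<in> carrier S" "star S s \<in> T"
    using assms by (auto simp: inverse_subsemigroup_def)
  then show ?thesis
    using assms(2) by (intro T.star_eqI) (simp_all add: mult_star_mult star_mult_star)
qed

lemma enlargement_morita_context:
  assumes sub: "inverse_subsemigroup T S" and enl: "enlargement S T"
  shows "morita_context S (S\<lparr>carrier := T\<rparr>) (set_prod S (carrier S) T) (\<otimes>) (\<otimes>)
    (\<lambda>x y. x \<otimes> star S y) (\<lambda>x y. star S x \<otimes> y)"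
proof -
  define X where "X = set_prod S (carrier S) T"
  have T: "T \<subseteq> carrier S" "\<And>a b. a \<in> T \<Longrightarrow> b \<in> T \<Longrightarrow> a \<otimes> b \<in> T" "\<And>a. a \<in> T \<Longrightarrow> star S a \<in> T"
    using sub by (auto simp: inverse_subsemigroup_def)
  have XI: "s \<otimes> t \<in> X" if "s \<in> carrier S" "t \<in> T" for s t
    using that by (auto simp: X_def set_prod_def)
  have XE: "\<exists>s t. s \<in> carrier S \<and> t \<in> T \<and> x = s \<otimes> t" if "x \<in> X" for x
    using that by (auto simp: X_def set_prod_def)
  have TS: "x \<in> carrier S" if "x \<in> T" for x
    using that T by auto
  have XS: "x \<in> carrier S" if "x \<in> X" for x
    using XE[OF that] TS mult_closed by auto
  have TST: "t \<otimes> s \<otimes> t' \<in> T" if "t \<in> T" "s \<in> carrier S" "t' \<in> T" for s t t'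
    using that enl unfolding enlargement_def set_prod_def by blast
  have lact_X: "s \<otimes> x \<in> X" if "s \<in> carrier S" "x \<in> X" for s x
    using XE[OF that(2)] that(1) XI mult_assoc[symmetric] TS mult_closed by auto
  have ract_X: "x \<otimes> t \<in> X" if "x \<in> X" "t \<in> T" for x t
    using XE[OF that(1)] that(2) XI mult_assoc TS T(2) by auto
  have rform_T: "star S x \<otimes> y \<in> T" if xy: "x \<in> X" "y \<in> X" for x y
  proof -
    obtain s t s' t' where st: "s \<in> carrier S" "t \<in> T" "x = s \<otimes> t" "s' \<in> carrier S" "t' \<in> T"
      "y = s' \<otimes> t'"
      using XE[OF xy(1)] XE[OF xy(2)] by blast
    \<comment> \<open>The star reverses the product st, which moves the T-factor of x to the outer
      left and exhibits an element of TST.\<close>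
    then have "star S x \<otimes> y = star S t \<otimes> (star S s \<otimes> s') \<otimes> t'"
      by (simp add: star_mult mult_assoc star_closed mult_closed TS)
    then show ?thesis
      using st TST T(3) star_closed mult_closed by simp
  qed
  note cl = mult_closed star_closed XS TS
  have lsurj: "(\<lambda>(x, y). x \<otimes> star S y) ` (X \<times> X) = carrier S"
  proof (intro equalityI subsetI)
    fix s assume "s \<in> carrier S"
    then obtain a t b where s: "a \<in> carrier S" "t \<in> T" "b \<in> carrier S" "s = a \<otimes> t \<otimes> b"
      using enl unfolding enlargement_def set_prod_def by blast
    \<comment> \<open>Inserting t* t after t changes nothing, but lets the second argument of the
      form end in a factor from T, as membership in ST requires.\<close>
    have "t \<otimes> (star S t \<otimes> (t \<otimes> b)) = (t \<otimes> (star S t \<otimes> t)) \<otimes> b"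
      using s by (simp add: mult_assoc cl)
    then have "s = (a \<otimes> t) \<otimes> star S (star S b \<otimes> (star S t \<otimes> t))"
      using s by (simp add: star_mult star_star mult_assoc cl mult_star_mult)
    moreover have "a \<otimes> t \<in> X" "star S b \<otimes> (star S t \<otimes> t) \<in> X"
      using s XI T star_closed by auto
    ultimately show "s \<in> (\<lambda>(x, y). x \<otimes> star S y) ` (X \<times> X)"
      by force
  qed (auto simp: cl)
  have rsurj: "(\<lambda>(x, y). star S x \<otimes> y) ` (X \<times> X) = T"
  proof (intro equalityI subsetI)
    fix t assume t: "t \<in> T"
    \<comment> \<open>The idempotent tt* is its own star and fixes t from the left. The second
      argument is t itself, written as t(t* t) to show that it lies in ST.\<close>
    then have "t = star S (t \<otimes> star S t) \<otimes> (t \<otimes> (star S t \<otimes> t))"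
      by (simp add: star_mult star_star mult_assoc cl mult_star_mult)
    moreover have "t \<otimes> star S t \<in> X" "t \<otimes> (star S t \<otimes> t) \<in> X"
      using t XI T TS by auto
    ultimately show "t \<in> (\<lambda>(x, y). star S x \<otimes> y) ` (X \<times> X)"
      by force
  qed (auto simp: rform_T)
  interpret T: inverse_semigroup "S\<lparr>carrier := T\<rparr>"
    by (rule inverse_subsemigroup_is_inverse_semigroup) fact
  show ?thesis
    unfolding X_def[symmetric]
  proof (unfold_locales, goal_cases)
    case 6 show ?case by (rule lsurj)
  next
    case 7 show ?case using rsurj by simp
  next
    \<comment> \<open>This is the symmetry law of the T-valued form, the only clause that mentions
      the star of the restricted structure. Both sides become y* x once that star is replaced by
      \<open>star S\<close>.\<close>
    case (12 x y)
    then show ?case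
      by (simp add: star_inverse_subsemigroup[OF sub rform_T] star_mult star_star cl)
  qed (simp_all add: lact_X ract_X star_mult star_star mult_assoc cl mult_star_mult)
qed

end

theorem proposition2p2:
  fixes S :: "('a, 'm) semigrp_scheme" and T :: "'a set"
  assumes "inverse_semigroup S"
    and "inverse_subsemigroup T S"
    and "enlargement S T"
  shows "strongly_morita_equivalent S (S\<lparr>carrier := T\<rparr>)"
  \<comment> \<open>The bimodule ST consists of elements of S, whereas the definition asks for a set
    of pairs; \<open>strongly_morita_equivalentI\<close> bridges this.\<close>
  using inverse_semigroup.enlargement_morita_context[OF assms] by (rule strongly_morita_equivalentI)

end
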